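(* Let $\mathcal{H}$ be a separable complex Hilbert space and $J\subseteq\mathbb{N}$ an index set. Suppose that $T$, $W$ are self-adjoint operators in $\mathcal{H}$ such that $\mathrm{dom}(|T|^{1/2})\subseteq\mathrm{dom}(|W|^{1/2})$, and let $c,d\in(0,\infty)$, $e\in[0,\infty)$. Moreover, suppose $\Phi_j\in\mathcal{B}(\mathcal{H})$, $j\in J$, leave $\mathrm{dom}(|T|^{1/2})$ invariant, that is, $\Phi_j\,\mathrm{dom}(|T|^{1/2})\subseteq\mathrm{dom}(|T|^{1/2})$, $j\in J$, and satisfy the following conditions: (i) $\sum_{j\in J}\Phi_j^*\Phi_j\le I_{\mathcal{H}}$. (ii) $\sum_{j\in J}\Phi_j^*|W|\Phi_j\ge c^{-1}|W|$ on $\mathrm{dom}(|T|^{1/2})$. (iii) $\sum_{j\in J}\big\||T|^{1/2}\Phi_jf\big\|_{\mathcal{H}}^2\le d\,\big\||T|^{1/2}f\big\|_{\mathcal{H}}^2+e\,\|f\|_{\mathcal{H}}^2$ for all $f\in\mathrm{dom}(|T|^{1/2})$. Let $a,b\in[0,\infty)$. Then $$\big\||W|^{1/2}\Phi_jf\big\|_{\mathcal{H}}^2\le a\,\big\||T|^{1/2}\Phi_jf\big\|_{\mathcal{H}}^2+b\,\|\Phi_jf\|_{\mathcal{H}}^2,\qquad f\in\mathrm{dom}(|T|^{1/2}),\ j\in J,$$ implies $$\big\||W|^{1/2}f\big\|_{\mathcal{H}}^2\le a\,c\,d\,\big\||T|^{1/2}f\big\|_{\mathcal{H}}^2+[a\,c\,e+b\,c]\,\|f\|_{\mathcal{H}}^2,\qquad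 f\in\mathrm{dom}(|T|^{1/2}).$$
   Context: $\mathcal{B}(\mathcal{H})$ denotes the bounded linear operators on $\mathcal{H}$. Infinite sums of operators are understood in the weak operator topology. Condition (ii) is understood in the sense of quadratic forms, i.e. $\sum_{j\in J}\||W|^{1/2}\Phi_jf\|_{\mathcal{H}}^2\ge c^{-1}\||W|^{1/2}f\|_{\mathcal{H}}^2$ for all $f\in\mathrm{dom}(|T|^{1/2})$. *)

theory Defs
  imports "HOL-Analysis.Analysis"
begin

section \<open>Complex Hilbert spaces\<close>

text \<open>
  The inner product is conjugate-linear in its first and linear in its second argument. Positive
  definiteness is contained in \<open>cinner_self\<close>, because the norm is definite.
\<close>

class complex_inner = real_normed_vector +
  fixes scaleC :: "complex \<Rightarrow> 'a \<Rightarrow> 'a"  (infixr "*\<^sub>C" 75)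
    and cinner :: "'a \<Rightarrow> 'a \<Rightarrow> complex"
  assumes scaleC_add_right: "a *\<^sub>C (x + y) = a *\<^sub>C x + a *\<^sub>C y"
    and scaleC_add_left: "(a + b) *\<^sub>C x = a *\<^sub>C x + b *\<^sub>C x"
    and scaleC_scaleC: "a *\<^sub>C b *\<^sub>C x = (a * b) *\<^sub>C x"
    and scaleR_scaleC: "r *\<^sub>R x = complex_of_real r *\<^sub>C x"
    and cinner_commute: "cinner x y = cnj (cinner y x)"
    and cinner_add_right: "cinner x (y + z) = cinner x y + cinner x z"
    and cinner_scaleC_right: "cinner x (a *\<^sub>C y) = a * cinner x y"
    and cinner_self: "cinner x x = complex_of_real ((norm x)\<^sup>2)"

class chilbert_space = complex_inner + complete_space

instantiation complex :: chilbert_space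
begin

definition scaleC_complex :: "complex \<Rightarrow> complex \<Rightarrow> complex" where
  "scaleC_complex a x = a * x"

definition cinner_complex :: "complex \<Rightarrow> complex \<Rightarrow> complex" where
  "cinner_complex x y = cnj x * y"

instance
  by standard
    (auto simp: scaleC_complex_def cinner_complex_def algebra_simps scaleR_conv_of_real
      complex_norm_square simp flip: of_real_power)

end


section \<open>Bounded operators\<close>

definition bounded_clinear :: "('a::complex_inner \<Rightarrow> 'a) \<Rightarrow> bool" where
  "bounded_clinear A \<longleftrightarrow> bounded_linear A \<and> (\<forall>c x. A (c *\<^sub>C x) = c *\<^sub>C A x)"

text \<open>The description is proper for bounded operators on a Hilbert space, by the Riesz representation theorem.\<close>

definition cadjoint :: "('a::complex_inner \<Rightarrow> 'a) \<Rightarrow> 'a \<Rightarrow> 'a" where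
  "cadjoint A = (THE B. \<forall>x y. cinner (B x) y = cinner x (A y))"

definition bounded_op_le :: "('a::complex_inner \<Rightarrow> 'a) \<Rightarrow> ('a \<Rightarrow> 'a) \<Rightarrow> bool" where
  "bounded_op_le A B \<longleftrightarrow> (\<forall>x. cinner x (B x - A x) \<in> \<real>\<^sub>\<ge>\<^sub>0)"

text \<open>Convergence of a sum in the weak operator topology of the bounded operators.\<close>

definition has_wot_sum :: "('i \<Rightarrow> 'a::complex_inner \<Rightarrow> 'a) \<Rightarrow> ('a \<Rightarrow> 'a) \<Rightarrow> 'i set \<Rightarrow> bool" where
  "has_wot_sum A S I \<longleftrightarrow>
     bounded_clinear S \<and> (\<forall>x y. ((\<lambda>i. cinner x (A i y)) has_sum cinner x (S y)) I)"


section \<open>Unbounded operators\<close>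

text \<open>
  An unbounded operator is identified with its graph, so that equality of operators includes
  equality of domains. The domain is \<^term>\<open>Domain T\<close>, and the product of operators on its
  maximal domain (first \<open>S\<close>, then \<open>T\<close>) is \<^term>\<open>S O T\<close>.
\<close>

type_synonym 'a unbounded_op = "('a \<times> 'a) set"

definition linear_op :: "'a::complex_inner unbounded_op \<Rightarrow> bool" where
  "linear_op T \<longleftrightarrow> single_valued T \<and> (0, 0) \<in> T \<and>
     (\<forall>x y x' y'. (x, y) \<in> T \<longrightarrow> (x', y') \<in> T \<longrightarrow> (x + x', y + y') \<in> T) \<and>
     (\<forall>c x y. (x, y) \<in> T \<longrightarrow> (c *\<^sub>C x, c *\<^sub>C y) \<in> T)"

definition op_app :: "'a unbounded_op \<Rightarrow> 'a \<Rightarrow> 'a" where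
  "op_app T x = (THE y. (x, y) \<in> T)"

definition op_adjoint :: "'a::complex_inner unbounded_op \<Rightarrow> 'a unbounded_op" where
  "op_adjoint T = {(y, z). \<forall>(x, w) \<in> T. cinner z x = cinner y w}"

definition self_adjoint :: "'a::complex_inner unbounded_op \<Rightarrow> bool" where
  "self_adjoint T \<longleftrightarrow> linear_op T \<and> closure (Domain T) = UNIV \<and> op_adjoint T = T"

definition nonneg_op :: "'a::complex_inner unbounded_op \<Rightarrow> bool" where
  "nonneg_op T \<longleftrightarrow> (\<forall>(x, y) \<in> T. cinner x y \<in> \<real>\<^sub>\<ge>\<^sub>0)"

text \<open>
  By the spectral theorem a nonnegative self-adjoint operator on a Hilbert space has exactly one
  nonnegative self-adjoint square root, so the description is proper for such operators. For
  self-adjoint \<open>T\<close> (indeed for closed densely defined \<open>T\<close>) this applies to \<open>T\<^sup>* T\<close>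
  and hence to \<open>|T| = (T\<^sup>* T)\<^sup>1\<^sup>/\<^sup>2\<close>.
\<close>

definition op_sqrt :: "'a::complex_inner unbounded_op \<Rightarrow> 'a unbounded_op" where
  "op_sqrt T = (THE S. self_adjoint S \<and> nonneg_op S \<and> S O S = T)"

definition op_abs :: "'a::complex_inner unbounded_op \<Rightarrow> 'a unbounded_op" where
  "op_abs T = op_sqrt (T O op_adjoint T)"

end

theory Submission
  imports Defs
begin

text \<open>
  The hypothesis on the vectors \<open>\<Phi>\<^sub>j f\<close> is summed over \<open>j\<close>. By (ii) the left-hand sides sum up to
  at least \<open>c\<^sup>-\<^sup>1 \<parallel>|W|\<^sup>1\<^sup>/\<^sup>2 f\<parallel>\<^sup>2\<close>. On the right, (iii) bounds
  \<open>\<Sum> \<parallel>|T|\<^sup>1\<^sup>/\<^sup>2 \<Phi>\<^sub>j f\<parallel>\<^sup>2\<close>, and (i) gives \<open>\<Sum> \<parallel>\<Phi>\<^sub>j f\<parallel>\<^sup>2 \<le> \<parallel>f\<parallel>\<^sup>2\<close>. Multiplication by \<open>c\<close> yields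
  the claim. The sums live in \<open>[0, \<infinity>]\<close> and are compared through
  their finite partial sums, which are real numbers.

  What does need an argument is the reading of (i) as a bound on \<open>\<Sum> \<parallel>\<Phi>\<^sub>j f\<parallel>\<^sup>2\<close>: the adjoint is defined
  by a description, whose defining equation \<open>cinner_cadjoint\<close> requires that an adjoint exists. This
  is the Riesz representation theorem, which is proved by minimising a quadratic functional
  (\<open>riesz_representation_Re\<close>).
\<close>

section \<open>The real part of the inner product\<close>

lemma cinner_add_left:
  "cinner (x + y) z = cinner x z + cinner (y :: 'a::complex_inner) z"
  by (metis cinner_add_right cinner_commute complex_cnj_add)

lemma cinner_scaleR_right:
  "cinner x (r *\<^sub>R y) = complex_of_real r * cinner x (y :: 'a::complex_inner)"
  by (simp add: scaleR_scaleC cinner_scaleC_right)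

lemma norm_add_squared:
  "(norm (x + y))\<^sup>2 = (norm x)\<^sup>2 + (norm y)\<^sup>2 + 2 * Re (cinner x (y :: 'a::complex_inner))"
proof -
  have "complex_of_real ((norm (x + y))\<^sup>2) = cinner x x + cinner y y + (cinner x y + cnj (cinner x y))"
    unfolding cinner_self[symmetric]
    by (simp add: cinner_add_left cinner_add_right flip: cinner_commute)
  also have "\<dots> = complex_of_real ((norm x)\<^sup>2 + (norm y)\<^sup>2 + 2 * Re (cinner x y))"
    unfolding cinner_self complex_add_cnj by simp
  finally show ?thesis
    by (simp only: of_real_eq_iff)
qed

lemma parallelogram_law:
  "(norm (x + y))\<^sup>2 + (norm (x - y))\<^sup>2 = 2 * (norm x)\<^sup>2 + 2 * (norm (y :: 'a::complex_inner))\<^sup>2"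
  using norm_add_squared[of x y] norm_add_squared[of x "-1 *\<^sub>R y"]
  unfolding cinner_scaleR_right by simp

text \<open>
  As the norm already satisfies the triangle inequality, the Cauchy--Schwarz inequality can be read
  off from polarisation.
\<close>

lemma Re_cinner_le: "\<bar>Re (cinner x y)\<bar> \<le> norm x * norm (y :: 'a::complex_inner)"
proof -
  have *: "Re (cinner x z) \<le> norm x * norm z" for z
  proof -
    have "(norm (x + z))\<^sup>2 \<le> (norm x + norm z)\<^sup>2"
      by (intro power_mono norm_triangle_ineq norm_ge_zero)
    then show ?thesis
      using norm_add_squared[of x z] by (simp add: power2_sum)
  qed
  from *[of y] *[of "-1 *\<^sub>R y"] show ?thesis
    unfolding cinner_scaleR_right by simp
qed

lemma bounded_linear_Re_cinner: "bounded_linear (\<lambda>y. Re (cinner x (y :: 'a::complex_inner)))"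
  by (rule bounded_linear_intro[where K = "norm x"])
    (simp_all add: cinner_add_right cinner_scaleR_right Re_cinner_le mult.commute[of _ "norm x"])

text \<open>
  An inner product is determined by its real part, because its imaginary part is recovered after
  multiplication of the second argument by \<open>\<i>\<close>.
\<close>

lemma eqI_Re_i:
  assumes "Re w = Re z" and "Re (\<i> * w) = Re (\<i> * z)"
  shows "w = z"
  using assms by (simp add: complex_eq_iff)


section \<open>Riesz representation and adjoints\<close>

text \<open>
  The representing vector minimises \<open>F y = \<parallel>y\<parallel>\<^sup>2 - 2 \<psi> y\<close>. This functional is bounded below since
  \<open>\<psi>\<close> is bounded, every minimising sequence is Cauchy by the parallelogram law, and the vanishing
  of the derivative of \<open>F\<close> at the minimum is the required identity.
\<close>

lemma riesz_representation_Re: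
  fixes \<psi> :: "'a::chilbert_space \<Rightarrow> real"
  assumes "bounded_linear \<psi>"
  obtains z where "\<And>y. Re (cinner z y) = \<psi> y"
proof -
  interpret bounded_linear \<psi> by fact
  define F where "F y = (norm y)\<^sup>2 - 2 * \<psi> y" for y
  define m where "m = (INF y. F y)"
  obtain K where K: "\<And>y. norm (\<psi> y) \<le> norm y * K"
    using bounded by blast
  have "- K\<^sup>2 \<le> F y" for y
  proof -
    have "\<psi> y \<le> norm y * K"
      using K[of y] by simp
    moreover have "0 \<le> (norm y - K)\<^sup>2"
      by simp
    ultimately show ?thesis
      unfolding F_def power2_diff by simp
  qed
  then have bdd: "bdd_below (range F)"
    by (intro bdd_belowI[of _ "- K\<^sup>2"]) auto
  have m_le: "m \<le> F y" for y
    unfolding m_def by (rule cINF_lower[OF bdd]) simp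
  have "\<exists>y. F y < m + inverse (real (Suc n))" for n
    using cINF_less_iff[of UNIV F "m + inverse (real (Suc n))"] bdd
    unfolding m_def by simp
  then obtain u where u: "\<And>n. F (u n) < m + inverse (real (Suc n))"
    by metis
  \<comment> \<open>The midpoint of \<open>x\<close> and \<open>y\<close> cannot undercut the infimum, which forces near-minimisers together.\<close>
  have close: "(norm (x - y))\<^sup>2 \<le> 2 * (F x - m) + 2 * (F y - m)" for x y
  proof -
    have "4 * m \<le> 4 * F ((1/2) *\<^sub>R (x + y))"
      using m_le by simp
    also have "\<dots> = (norm (x + y))\<^sup>2 - 4 * \<psi> x - 4 * \<psi> y"
      by (simp add: F_def scaleR add power_divide add_divide_distrib)
    also have "\<dots> = 2 * F x + 2 * F y - (norm (x - y))\<^sup>2"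
      using parallelogram_law[of x y] by (simp add: F_def)
    finally show ?thesis by simp
  qed
  have "Cauchy u"
  proof (rule CauchyI)
    fix \<epsilon> :: real
    assume "\<epsilon> > 0"
    then obtain N where N: "inverse (real (Suc N)) < \<epsilon>\<^sup>2 / 4"
      using reals_Archimedean[of "\<epsilon>\<^sup>2 / 4"] by auto
    have near: "F (u n) - m < \<epsilon>\<^sup>2 / 4" if "n \<ge> N" for n
    proof -
      have "inverse (real (Suc n)) \<le> inverse (real (Suc N))"
        using that by (intro le_imp_inverse_le) auto
      then show ?thesis
        using u[of n] N by linarith
    qed
    have "norm (u n - u k) < \<epsilon>" if "n \<ge> N" "k \<ge> N" for n k
    proof (rule power2_less_imp_less)
      show "(norm (u n - u k))\<^sup>2 < \<epsilon>\<^sup>2"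
        using close[of "u n" "u k"] near[OF that(1)] near[OF that(2)] by simp
    qed (use \<open>\<epsilon> > 0\<close> in simp)
    then show "\<exists>N. \<forall>n\<ge>N. \<forall>k\<ge>N. norm (u n - u k) < \<epsilon>"
      by blast
  qed
  then obtain z where z: "u \<longlonglongrightarrow> z"
    using Cauchy_convergent convergent_def by blast
  have "(\<lambda>n. F (u n)) \<longlonglongrightarrow> F z"
    unfolding F_def by (intro tendsto_intros tendsto z)
  moreover have "(\<lambda>n. m + inverse (real (Suc n))) \<longlonglongrightarrow> m + 0"
    by (intro tendsto_intros LIMSEQ_inverse_real_of_nat)
  ultimately have "F z \<le> m"
    using u by (intro LIMSEQ_le[of _ "F z" _ m]) (auto intro: less_imp_le)
  have "Re (cinner z y) = \<psi> y" for y
  proof -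
    define p where "p = Re (cinner z y) - \<psi> y"
    define N where "N = (norm y)\<^sup>2 + 1"
    have N: "N > 0"
      unfolding N_def by (simp add: add_nonneg_pos)
    have quad: "0 \<le> t\<^sup>2 * (norm y)\<^sup>2 + 2 * t * p" for t
    proof -
      have "F (z + t *\<^sub>R y) = F z + (t\<^sup>2 * (norm y)\<^sup>2 + 2 * t * p)"
        unfolding F_def norm_add_squared cinner_scaleR_right
        by (simp add: p_def add scaleR power_mult_distrib algebra_simps)
      then show ?thesis
        using m_le[of "z + t *\<^sub>R y"] \<open>F z \<le> m\<close> by simp
    qed
    \<comment> \<open>The step \<open>- p / N\<close> would make the quadratic negative if \<open>p \<noteq> 0\<close>.\<close>
    have "0 \<le> N\<^sup>2 * ((- p / N)\<^sup>2 * (norm y)\<^sup>2 + 2 * (- p / N) * p)"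
      using quad[of "- p / N"] by (intro mult_nonneg_nonneg) auto
    also have "\<dots> = p\<^sup>2 * (N - 1) - 2 * N * p\<^sup>2"
    proof -
      have "(norm y)\<^sup>2 = N - 1"
        by (simp add: N_def)
      then show ?thesis
        using N by (simp only:) (simp add: power2_eq_square field_simps)
    qed
    also have "\<dots> = - (p\<^sup>2 * (N + 1))"
      by (simp add: algebra_simps)
    finally have "p\<^sup>2 * (N + 1) \<le> 0"
      by simp
    then have "p = 0"
      using N by (simp add: mult_le_0_iff)
    then show ?thesis
      by (simp add: p_def)
  qed
  then show thesis
    by (rule that)
qed

lemma cinner_ext_left:
  assumes "\<And>y. cinner x y = cinner x' (y :: 'a::complex_inner)"
  shows "x = x'"
proof -
  have "cinner (x - x') (x - x') + cinner x' (x - x') = cinner x (x - x')"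
    by (simp flip: cinner_add_left)
  then have "complex_of_real ((norm (x - x'))\<^sup>2) = 0"
    unfolding cinner_self[symmetric] using assms[of "x - x'"] by simp
  then show ?thesis
    by simp
qed

lemma cinner_cadjoint:
  fixes A :: "'a::chilbert_space \<Rightarrow> 'a"
  assumes "bounded_clinear A"
  shows "cinner (cadjoint A x) y = cinner x (A y)"
proof -
  have bl: "bounded_linear A" and homogeneous: "\<And>c x. A (c *\<^sub>C x) = c *\<^sub>C A x"
    using assms by (auto simp: bounded_clinear_def)
  have "\<exists>w. \<forall>y. cinner w y = cinner x (A y)" for x
  proof -
    obtain w where w: "\<And>y. Re (cinner w y) = Re (cinner x (A y))"
      using riesz_representation_Re[OF bounded_linear_compose[OF bounded_linear_Re_cinner bl]]
      by blast
    have "cinner w y = cinner x (A y)" for y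
      using w[of y] w[of "\<i> *\<^sub>C y"] unfolding homogeneous cinner_scaleC_right by (rule eqI_Re_i)
    then show ?thesis by blast
  qed
  then obtain B where B: "\<forall>x y. cinner (B x) y = cinner x (A y)"
    by metis
  have "\<forall>x y. cinner (cadjoint A x) y = cinner x (A y)"
    unfolding cadjoint_def
  proof (rule theI[where P = "\<lambda>B. \<forall>x y. cinner (B x) y = cinner x (A y)"])
    show "C = B" if "\<forall>x y. cinner (C x) y = cinner x (A y)" for C
      by (rule ext, rule cinner_ext_left) (use that B in simp)
  qed fact
  then show ?thesis by simp
qed

text \<open>
  Weak convergence is used on the diagonal only, where \<open>cinner f (A\<^sub>i\<^sup>* (A\<^sub>i f)) = \<parallel>A\<^sub>i f\<parallel>\<^sup>2\<close> by the
  defining property of the adjoint.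
\<close>

lemma has_sum_norm_squared_of_wot_sum:
  fixes A :: "'i \<Rightarrow> 'a::chilbert_space \<Rightarrow> 'a"
  assumes "\<And>i. i \<in> I \<Longrightarrow> bounded_clinear (A i)"
    and "has_wot_sum (\<lambda>i. cadjoint (A i) \<circ> A i) S I"
  shows "((\<lambda>i. (norm (A i f))\<^sup>2) has_sum Re (cinner f (S f))) I"
proof -
  have "Re (cinner f (cadjoint (A i) (A i f))) = (norm (A i f))\<^sup>2" if "i \<in> I" for i
  proof -
    have "cinner f (cadjoint (A i) (A i f)) = cnj (cinner (A i f) (A i f))"
      by (subst cinner_commute) (simp only: cinner_cadjoint[OF assms(1)[OF that]])
    then show ?thesis
      unfolding cinner_self by simp
  qed
  then have "((\<lambda>i. (norm (A i f))\<^sup>2) has_sum Re (cinner f (S f))) I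
    \<longleftrightarrow> ((\<lambda>i. Re (cinner f (cadjoint (A i) (A i f)))) has_sum Re (cinner f (S f))) I"
    by (metis (no_types, lifting) has_sum_cong)
  moreover have "((\<lambda>i. cinner f (cadjoint (A i) (A i f))) has_sum cinner f (S f)) I"
    using assms(2) unfolding has_wot_sum_def comp_def by blast
  then have "((\<lambda>i. Re (cinner f (cadjoint (A i) (A i f)))) has_sum Re (cinner f (S f))) I"
    by (rule has_sum_Re)
  ultimately show ?thesis
    by (rule iffD2)
qed

lemma sum_norm_squared_le_of_wot_sum:
  fixes A :: "'i \<Rightarrow> 'a::chilbert_space \<Rightarrow> 'a"
  assumes "\<And>i. i \<in> I \<Longrightarrow> bounded_clinear (A i)"
    and "has_wot_sum (\<lambda>i. cadjoint (A i) \<circ> A i) S I" and "bounded_op_le S id"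
    and "finite F" and "F \<subseteq> I"
  shows "(\<Sum>i\<in>F. (norm (A i f))\<^sup>2) \<le> (norm f)\<^sup>2"
proof -
  have "(\<Sum>i\<in>F. (norm (A i f))\<^sup>2) \<le> Re (cinner f (S f))"
  proof (rule finite_sum_le_has_sum)
    show "((\<lambda>i. (norm (A i f))\<^sup>2) has_sum Re (cinner f (S f))) I"
      using assms(1,2)
      by (rule has_sum_norm_squared_of_wot_sum[where A = A and f = f])
  qed (use assms(4,5) in simp_all)
  also have "\<dots> \<le> (norm f)\<^sup>2"
  proof -
    have "cinner f (f - S f) \<in> \<real>\<^sub>\<ge>\<^sub>0"
      using assms(3) by (simp add: bounded_op_le_def)
    then have "0 \<le> Re (cinner f (f - S f))"
      by (simp add: complex_nonneg_Reals_iff)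
    moreover have "cinner f (f - S f) + cinner f (S f) = cinner f f"
      by (simp flip: cinner_add_right)
    from arg_cong[OF this, of Re]
    have "Re (cinner f (f - S f)) + Re (cinner f (S f)) = (norm f)\<^sup>2"
      unfolding cinner_self plus_complex.sel Re_complex_of_real .
    ultimately show ?thesis by simp
  qed
  finally show ?thesis .
qed


section \<open>Summation of the local bounds\<close>

lemma sum_le_of_infsum_ennreal_le:
  fixes g :: "'i \<Rightarrow> real"
  assumes "(\<Sum>\<^sub>\<infinity>i\<in>I. ennreal (g i)) \<le> ennreal B" and "\<And>i. 0 \<le> g i" and "0 \<le> B"
    and "finite F" and "F \<subseteq> I"
  shows "sum g F \<le> B"
proof -
  have "ennreal (sum g F) = (\<Sum>i\<in>F. ennreal (g i))"
    using assms(2) by simp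
  also have "\<dots> \<le> (\<Sum>\<^sub>\<infinity>i\<in>I. ennreal (g i))"
    using assms(4,5) by (subst nonneg_infsum_complete) (auto intro: SUP_upper)
  also note assms(1)
  finally show ?thesis
    using assms(3) by simp
qed

lemma infsum_ennreal_le_of_sum_le:
  fixes g :: "'i \<Rightarrow> real"
  assumes "\<And>F. finite F \<Longrightarrow> F \<subseteq> I \<Longrightarrow> sum g F \<le> B" and "\<And>i. 0 \<le> g i"
  shows "(\<Sum>\<^sub>\<infinity>i\<in>I. ennreal (g i)) \<le> ennreal B"
  using assms
  by (subst nonneg_infsum_complete) (auto intro!: SUP_least simp: ennreal_leI)

theorem theorem3p2:
  fixes T W :: "'a::chilbert_space unbounded_op"
    and J :: "nat set"
    and \<Phi> :: "nat \<Rightarrow> 'a \<Rightarrow> 'a"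
    and a b c d e :: real
  assumes "separable_space (euclidean :: 'a topology)"
    and "self_adjoint T" and "self_adjoint W"
    and "Domain (op_sqrt (op_abs T)) \<subseteq> Domain (op_sqrt (op_abs W))"
    and "c > 0" and "d > 0" and "e \<ge> 0"
    and "\<And>j. j \<in> J \<Longrightarrow> bounded_clinear (\<Phi> j)"
    and "\<And>j. j \<in> J \<Longrightarrow> \<Phi> j ` Domain (op_sqrt (op_abs T)) \<subseteq> Domain (op_sqrt (op_abs T))"
    and cond_i: "\<exists>S. has_wot_sum (\<lambda>j. cadjoint (\<Phi> j) \<circ> \<Phi> j) S J \<and> bounded_op_le S id"
    and cond_ii: "\<And>f. f \<in> Domain (op_sqrt (op_abs T)) \<Longrightarrow>
      (\<Sum>\<^sub>\<infinity>j\<in>J. ennreal ((norm (op_app (op_sqrt (op_abs W)) (\<Phi> j f)))\<^sup>2))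
        \<ge> ennreal (inverse c * (norm (op_app (op_sqrt (op_abs W)) f))\<^sup>2)"
    and cond_iii: "\<And>f. f \<in> Domain (op_sqrt (op_abs T)) \<Longrightarrow>
      (\<Sum>\<^sub>\<infinity>j\<in>J. ennreal ((norm (op_app (op_sqrt (op_abs T)) (\<Phi> j f)))\<^sup>2))
        \<le> ennreal (d * (norm (op_app (op_sqrt (op_abs T)) f))\<^sup>2 + e * (norm f)\<^sup>2)"
    and "a \<ge> 0" and "b \<ge> 0"
  shows "(\<forall>f \<in> Domain (op_sqrt (op_abs T)). \<forall>j \<in> J.
      (norm (op_app (op_sqrt (op_abs W)) (\<Phi> j f)))\<^sup>2
        \<le> a * (norm (op_app (op_sqrt (op_abs T)) (\<Phi> j f)))\<^sup>2 + b * (norm (\<Phi> j f))\<^sup>2)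
    \<longrightarrow> (\<forall>f \<in> Domain (op_sqrt (op_abs T)).
      (norm (op_app (op_sqrt (op_abs W)) f))\<^sup>2
        \<le> a * c * d * (norm (op_app (op_sqrt (op_abs T)) f))\<^sup>2
          + (a * c * e + b * c) * (norm f)\<^sup>2)"
proof (intro impI ballI)
  fix f
  let ?T = "\<lambda>g. (norm (op_app (op_sqrt (op_abs T)) g))\<^sup>2"
  let ?W = "\<lambda>g. (norm (op_app (op_sqrt (op_abs W)) g))\<^sup>2"
  assume "\<forall>f \<in> Domain (op_sqrt (op_abs T)). \<forall>j \<in> J.
      ?W (\<Phi> j f) \<le> a * ?T (\<Phi> j f) + b * (norm (\<Phi> j f))\<^sup>2"
    and f: "f \<in> Domain (op_sqrt (op_abs T))"
  then have local_bound: "?W (\<Phi> j f) \<le> a * ?T (\<Phi> j f) + b * (norm (\<Phi> j f))\<^sup>2" if "j \<in> J" for j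
    using that by blast
  define B where "B = a * (d * ?T f + e * (norm f)\<^sup>2) + b * (norm f)\<^sup>2"
  have nonneg: "0 \<le> d * ?T f + e * (norm f)\<^sup>2"
    using \<open>d > 0\<close> \<open>e \<ge> 0\<close> by simp
  then have "0 \<le> B"
    unfolding B_def using \<open>a \<ge> 0\<close> \<open>b \<ge> 0\<close> by simp
  obtain S where S: "has_wot_sum (\<lambda>j. cadjoint (\<Phi> j) \<circ> \<Phi> j) S J" "bounded_op_le S id"
    using cond_i by blast
  have "(\<Sum>j\<in>F. ?W (\<Phi> j f)) \<le> B" if F: "finite F" "F \<subseteq> J" for F
  proof -
    have "(\<Sum>j\<in>F. ?W (\<Phi> j f)) \<le> (\<Sum>j\<in>F. a * ?T (\<Phi> j f) + b * (norm (\<Phi> j f))\<^sup>2)"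
      using F local_bound by (intro sum_mono) blast
    also have "\<dots> = a * (\<Sum>j\<in>F. ?T (\<Phi> j f)) + b * (\<Sum>j\<in>F. (norm (\<Phi> j f))\<^sup>2)"
      by (simp add: sum.distrib sum_distrib_left)
    also have "\<dots> \<le> B"
      unfolding B_def
    proof (intro add_mono mult_left_mono \<open>a \<ge> 0\<close> \<open>b \<ge> 0\<close>)
      show "(\<Sum>j\<in>F. ?T (\<Phi> j f)) \<le> d * ?T f + e * (norm f)\<^sup>2"
        using cond_iii[OF f] nonneg F by (intro sum_le_of_infsum_ennreal_le) auto
      show "(\<Sum>j\<in>F. (norm (\<Phi> j f))\<^sup>2) \<le> (norm f)\<^sup>2"
        using assms(8) S F by (rule sum_norm_squared_le_of_wot_sum[where A = \<Phi> and f = f])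
    qed
    finally show ?thesis .
  qed
  then have "(\<Sum>\<^sub>\<infinity>j\<in>J. ennreal (?W (\<Phi> j f))) \<le> ennreal B"
    by (intro infsum_ennreal_le_of_sum_le) auto
  with cond_ii[OF f] have "ennreal (inverse c * ?W f) \<le> ennreal B"
    by (rule order_trans)
  then have "inverse c * ?W f \<le> B"
    using \<open>0 \<le> B\<close> by simp
  then have "?W f \<le> c * B"
    using \<open>c > 0\<close> by (simp add: field_simps)
  also have "c * B = a * c * d * ?T f + (a * c * e + b * c) * (norm f)\<^sup>2"
    by (simp add: B_def algebra_simps)
  finally show "?W f \<le> a * c * d * ?T f + (a * c * e + b * c) * (norm f)\<^sup>2" .
qed

end
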